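(* Let $\mathbf X\in\mathbb R^{n\times d}$ with $n\ge d$ be a full rank matrix and let $s\in\{d,\dots,n\}$. Let $S$ be sampled according to size $s$ volume sampling over $\mathbf X$. If size $s$ volume sampling over $\mathbf X$ has full support, then $$\mathbb E\big[(\mathbf X_S^\top\mathbf X_S)^{-1}\big]=\frac{n-d+1}{s-d+1}\,(\mathbf X^\top\mathbf X)^{-1}.$$ If it does not have full support, then $$\mathbb E\big[(\mathbf X_S^\top\mathbf X_S)^{-1}\big]\preceq\frac{n-d+1}{s-d+1}\,(\mathbf X^\top\mathbf X)^{-1}.$$
   Context: $\mathbf X_S$ is the submatrix of the rows of $\mathbf X$ indexed by $S$. Size $s$ volume sampling over $\mathbf X$ selects a set $S\subseteq\{1,\dots,n\}$ with $|S|=s$ with probability $P(S)=\dfrac{\det(\mathbf X_S^\top\mathbf X_S)}{\binom{n-d}{s-d}\det(\mathbf X^\top\mathbf X)}$. It has full support if $\det(\mathbf X_S^\top\mathbf X_S)>0$ for all $S$ with $|S|=s$. The expectation is the sum over sets $S$ with $P(S)>0$ (for which the inverse exists). $\mathbf A\preceq\mathbf B$ means that $\mathbf B-\mathbf A$ is positive semidefinite. *)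

theory Defs
  imports
    "Jordan_Normal_Form.DL_Rank"
    "Jordan_Normal_Form.DL_Submatrix"
    "Jordan_Normal_Form.Gauss_Jordan_Elimination"
begin

text \<open>Rows of an \<open>n \<times> d\<close> matrix are indexed by \<open>{0..<n}\<close>.\<close>

definition row_submatrix :: "real mat \<Rightarrow> nat set \<Rightarrow> real mat" where
  "row_submatrix X S = submatrix X S UNIV"

definition gram :: "real mat \<Rightarrow> real mat" where
  "gram A = transpose_mat A * A"

text \<open>The library's \<^const>\<open>mat_inverse\<close> is option-valued: it returns \<open>None\<close> on a singular matrix,
  where the value of \<open>mat_inv\<close> is unspecified.\<close>

definition mat_inv :: "real mat \<Rightarrow> real mat" where
  "mat_inv A = the (mat_inverse A)"

definition row_sets :: "nat \<Rightarrow> nat \<Rightarrow> nat set set" where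
  "row_sets n s = {S. S \<subseteq> {0..<n} \<and> card S = s}"

text \<open>The probability mass of \<open>S\<close> under size \<open>s\<close> volume sampling over \<open>X\<close>, meaningful for
  \<open>S \<in> row_sets (dim_row X) s\<close>.\<close>

definition vol_prob :: "real mat \<Rightarrow> nat \<Rightarrow> nat set \<Rightarrow> real" where
  "vol_prob X s S =
     det (gram (row_submatrix X S)) /
     (real ((dim_row X - dim_col X) choose (s - dim_col X)) * det (gram X))"

definition vol_full_support :: "real mat \<Rightarrow> nat \<Rightarrow> bool" where
  "vol_full_support X s \<longleftrightarrow>
     (\<forall>S \<in> row_sets (dim_row X) s. det (gram (row_submatrix X S)) > 0)"

text \<open>Entrywise expectation of a \<open>d \<times> d\<close> matrix-valued function of the sampled set, where
  \<open>d = dim_col X\<close>. Only sets of positive probability contribute, so \<open>F\<close> may be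
  unspecified elsewhere.\<close>

definition vol_expectation :: "real mat \<Rightarrow> nat \<Rightarrow> (nat set \<Rightarrow> real mat) \<Rightarrow> real mat" where
  "vol_expectation X s F = mat (dim_col X) (dim_col X) (\<lambda>(i, j).
     \<Sum>S \<in> {S \<in> row_sets (dim_row X) s. vol_prob X s S > 0}. vol_prob X s S * F S $$ (i, j))"

definition psd_mat :: "real mat \<Rightarrow> bool" where
  "psd_mat A \<longleftrightarrow> square_mat A \<and> transpose_mat A = A \<and>
     (\<forall>v \<in> carrier_vec (dim_row A). 0 \<le> v \<bullet> (A *\<^sub>v v))"

text \<open>Matrix subtraction is total, so equality of dimensions is required explicitly.\<close>

definition loewner_le :: "real mat \<Rightarrow> real mat \<Rightarrow> bool" (infix "\<preceq>\<^sub>L" 50) where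
  "A \<preceq>\<^sub>L B \<longleftrightarrow>
     dim_row A = dim_row B \<and> dim_col A = dim_col B \<and> psd_mat (B - A)"

end

theory Submission
  imports Defs
begin

text \<open>
  Write \<open>G\<^sub>S = X\<^sub>S\<^sup>T X\<^sub>S\<close>. Where \<open>P(S) > 0\<close>, Cramer's rule \<open>G\<^sub>S\<^sup>-\<^sup>1 = adj G\<^sub>S / det G\<^sub>S\<close>
  cancels the determinant in \<open>P(S)\<close>, so the expectation is a constant multiple of the sum of
  \<open>adj G\<^sub>S\<close> over the nonsingular \<open>G\<^sub>S\<close>. By Cauchy-Binet the entries of \<open>adj G\<^sub>S\<close> are sums over
  the \<open>(d - 1)\<close>-subsets \<open>T\<close> of \<open>S\<close> of terms depending only on \<open>T\<close>, and each \<open>T\<close> lies in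
  \<open>(n - d + 1) choose (s - d + 1)\<close> sets \<open>S\<close>; hence the sum of \<open>adj G\<^sub>S\<close> over all \<open>S\<close> is that
  multiple of \<open>adj (X\<^sup>T X)\<close>. The two sides therefore differ by a positive multiple of the
  sum of \<open>adj G\<^sub>S\<close> over the singular \<open>G\<^sub>S\<close>, and every \<open>adj G\<^sub>S\<close> is positive semidefinite.
\<close>


section \<open>Cauchy-Binet expansions\<close>

text \<open>Row \<open>a\<close> is the combination of the rows \<open>B r\<close> with coefficients
  \<open>A r a\<close>, so multilinearity of the determinant in its rows leaves one choice
  \<open>f a\<close> of a summand per row.\<close>

lemma det_sum_outer:
  fixes A B :: "nat \<Rightarrow> nat \<Rightarrow> 'a :: comm_ring_1"
  assumes "finite S"
  shows "det (mat k k (\<lambda>(a, b). \<Sum>r\<in>S. A r a * B r b)) =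
    (\<Sum>f\<in>{0..<k} \<rightarrow>\<^sub>E S. (\<Prod>a = 0..<k. A (f a) a) * det (mat k k (\<lambda>(a, b). B (f a) b)))"
proof -
  let ?F = "{0..<k} \<rightarrow>\<^sub>E S" and ?P = "{p. p permutes {0..<k}}"
  have "det (mat k k (\<lambda>(a, b). \<Sum>r\<in>S. A r a * B r b)) =
      (\<Sum>p\<in>?P. signof p * (\<Prod>a = 0..<k. \<Sum>r\<in>S. A r a * B r (p a)))"
    by (subst det_def'[of _ k]) (auto intro!: sum.cong prod.cong dest: permutes_in_image)
  also have "\<dots> = (\<Sum>p\<in>?P. signof p * (\<Sum>f\<in>?F. \<Prod>a = 0..<k. A (f a) a * B (f a) (p a)))"
    using assms by (subst prod_sum_PiE) auto
  also have "\<dots> = (\<Sum>f\<in>?F. \<Sum>p\<in>?P. (\<Prod>a = 0..<k. A (f a) a) * (signof p * (\<Prod>a = 0..<k. B (f a) (p a))))"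
    by (subst sum.swap) (simp add: sum_distrib_left prod.distrib mult_ac)
  also have "\<dots> = (\<Sum>f\<in>?F. (\<Prod>a = 0..<k. A (f a) a) * det (mat k k (\<lambda>(a, b). B (f a) b)))"
    unfolding sum_distrib_left[symmetric]
    by (subst det_def'[of _ k]) (auto intro!: sum.cong prod.cong arg_cong2[of _ _ _ _ "(*)"] dest: permutes_in_image)
  finally show ?thesis .
qed

text \<open>Cauchy-Binet over all index functions rather than subsets (whence the factor \<open>fact k\<close>):
  average the previous expansion over all reorderings of \<open>f\<close>.\<close>

lemma det_sum_outer_symmetric:
  fixes A B :: "nat \<Rightarrow> nat \<Rightarrow> 'a :: {comm_ring_1, ring_char_0}"
  assumes "finite S"
  shows "fact k * det (mat k k (\<lambda>(a, b). \<Sum>r\<in>S. A r a * B r b)) =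
    (\<Sum>f\<in>{0..<k} \<rightarrow>\<^sub>E S. det (mat k k (\<lambda>(a, b). A (f a) b)) * det (mat k k (\<lambda>(a, b). B (f a) b)))"
    (is "_ * ?D = _")
proof -
  let ?F = "{0..<k} \<rightarrow>\<^sub>E S" and ?P = "{p. p permutes {0..<k}}"
  \<comment> \<open>Reindexing by \<open>f \<mapsto> f \<circ> q\<close> moves \<open>p\<close> into
    the product and permutes the rows of the \<open>B\<close> matrix at the cost of
    \<open>signof p\<close>. Summed over \<open>p\<close>, the \<open>A\<close> factors then form a
    Leibniz expansion.\<close>
  have D: "?D = (\<Sum>f\<in>?F. signof p * (\<Prod>a = 0..<k. A (f a) (p a)) * det (mat k k (\<lambda>(a, b). B (f a) b)))"
    if p: "p permutes {0..<k}" for p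
  proof -
    let ?h = "\<lambda>f. (\<Prod>a = 0..<k. A (f a) a) * det (mat k k (\<lambda>(a, b). B (f a) b))"
    define q where "q = Hilbert_Choice.inv p"
    have q: "q permutes {0..<k}" "p (q a) = a" "q (p a) = a" "sign q = sign p" for a
      using permutes_inv[OF p] permutes_inverses[OF p, of a] sign_inverse[of p] p
      unfolding q_def by (auto simp: permutation_permutes)
    \<comment> \<open>Precomposition must not disturb the values outside \<open>{0..<k}\<close>,
      where \<open>f\<close> is \<open>undefined\<close>.\<close>
    have lt: "p a < k \<longleftrightarrow> a < k" "q a < k \<longleftrightarrow> a < k" for a
      using permutes_in_image[OF p, of a] permutes_in_image[OF q(1), of a] by auto
    have "?D = sum ?h ?F" by (rule det_sum_outer[OF assms])
    also have "\<dots> = (\<Sum>f\<in>?F. ?h (\<lambda>a. f (q a)))"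
      by (rule sum.reindex_bij_witness[of _ "\<lambda>f a. f (q a)" "\<lambda>f a. f (p a)"])
        (auto simp: q PiE_iff extensional_def lt)
    also have "\<dots> = (\<Sum>f\<in>?F. signof p * (\<Prod>a = 0..<k. A (f a) (p a)) * det (mat k k (\<lambda>(a, b). B (f a) b)))"
    proof (rule sum.cong[OF refl])
      fix f
      have "(\<Prod>a = 0..<k. A (f (q a)) a) = (\<Prod>a = 0..<k. A (f a) (p a))"
        using prod.permute[OF p, of "\<lambda>a. A (f (q a)) a"] by (simp add: o_def q)
      moreover have "det (mat k k (\<lambda>(a, b). B (f (q a)) b)) = signof p * det (mat k k (\<lambda>(a, b). B (f a) b))"
      proof -
        have "mat k k (\<lambda>(a, b). B (f (q a)) b) = mat k k (\<lambda>(a, b). mat k k (\<lambda>(a, b). B (f a) b) $$ (q a, b))"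
          by (rule eq_matI) (auto simp: lt)
        then show ?thesis
          using det_permute_rows[OF _ q(1), of "mat k k (\<lambda>(a, b). B (f a) b)"] by (simp add: q)
      qed
      ultimately show "?h (\<lambda>a. f (q a)) =
          signof p * (\<Prod>a = 0..<k. A (f a) (p a)) * det (mat k k (\<lambda>(a, b). B (f a) b))"
        by (simp add: mult_ac)
    qed
    finally show ?thesis .
  qed
  have "fact k * ?D = (\<Sum>p\<in>?P. ?D)"
    using card_permutations[of "{0..<k}" k] by simp
  also have "\<dots> = (\<Sum>p\<in>?P. \<Sum>f\<in>?F. signof p * (\<Prod>a = 0..<k. A (f a) (p a)) * det (mat k k (\<lambda>(a, b). B (f a) b)))"
    by (rule sum.cong[OF refl]) (use D in blast)
  also have "\<dots> = (\<Sum>f\<in>?F. (\<Sum>p\<in>?P. signof p * (\<Prod>a = 0..<k. A (f a) (p a))) * det (mat k k (\<lambda>(a, b). B (f a) b)))"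
    by (subst sum.swap) (simp add: sum_distrib_right)
  also have "\<dots> = (\<Sum>f\<in>?F. det (mat k k (\<lambda>(a, b). A (f a) b)) * det (mat k k (\<lambda>(a, b). B (f a) b)))"
    by (subst (2) det_def'[of _ k])
      (auto intro!: sum.cong prod.cong arg_cong2[of _ _ _ _ "(*)"] dest: permutes_in_image)
  finally show ?thesis .
qed

section \<open>Summation over all sets of \<open>s\<close> rows\<close>

lemma card_row_sets_superset:
  assumes "T \<subseteq> {0..<n}" "card T \<le> s"
  shows "card {S \<in> row_sets n s. T \<subseteq> S} = (n - card T) choose (s - card T)"
proof -
  have fT: "finite T" using assms(1) finite_subset by blast
  have "bij_betw (\<lambda>U. U \<union> T) {U. U \<subseteq> {0..<n} - T \<and> card U = s - card T} {S \<in> row_sets n s. T \<subseteq> S}"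
  proof (rule bij_betw_byWitness[where f' = "\<lambda>S. S - T"])
    show "(\<lambda>U. U \<union> T) ` {U. U \<subseteq> {0..<n} - T \<and> card U = s - card T} \<subseteq> {S \<in> row_sets n s. T \<subseteq> S}"
    proof clarify
      fix U assume U: "U \<subseteq> {0..<n} - T" "card U = s - card T"
      then have "finite U" "U \<inter> T = {}" by (auto intro: finite_subset)
      then have "card (U \<union> T) = s" using U assms fT by (simp add: card_Un_disjoint)
      then show "U \<union> T \<in> row_sets n s \<and> T \<subseteq> U \<union> T"
        using U assms by (auto simp: row_sets_def)
    qed
  qed (use fT in \<open>auto simp: row_sets_def card_Diff_subset\<close>)
  then have "card {S \<in> row_sets n s. T \<subseteq> S} = card {U. U \<subseteq> {0..<n} - T \<and> card U = s - card T}"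
    by (rule bij_betw_same_card[symmetric])
  also have "\<dots> = (n - card T) choose (s - card T)"
    using assms fT by (simp add: n_subsets card_Diff_subset)
  finally show ?thesis .
qed

lemma finite_row_sets: "finite (row_sets n s)"
  unfolding row_sets_def by simp

text \<open>After expansion over index functions, the term of \<open>f\<close> occurs once for each
  \<open>S\<close> containing the image of \<open>f\<close>. Only injective \<open>f\<close> matter;
  their images have exactly \<open>k\<close> elements, so the count is the same for all of
  them.\<close>

lemma sum_row_sets_det_sum_outer:
  fixes A B :: "nat \<Rightarrow> nat \<Rightarrow> 'a :: comm_ring_1"
  assumes "k \<le> s"
  shows "(\<Sum>S\<in>row_sets n s. det (mat k k (\<lambda>(a, b). \<Sum>r\<in>S. A r a * B r b))) =
    of_nat ((n - k) choose (s - k)) * det (mat k k (\<lambda>(a, b). \<Sum>r\<in>{0..<n}. A r a * B r b))"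
proof -
  let ?F = "\<lambda>S. {0..<k} \<rightarrow>\<^sub>E S"
  let ?g = "\<lambda>f. (\<Prod>a = 0..<k. A (f a) a) * det (mat k k (\<lambda>(a, b). B (f a) b))"
  have finF: "finite (?F {0..<n})" by (simp add: finite_PiE)
  have count: "of_nat (card {S \<in> row_sets n s. f ` {0..<k} \<subseteq> S}) * ?g f =
      of_nat ((n - k) choose (s - k)) * ?g f" if f: "f \<in> ?F {0..<n}" for f
  proof (cases "inj_on f {0..<k}")
    case True
    then show ?thesis
      using card_row_sets_superset[of "f ` {0..<k}" n s] f assms
      by (auto simp: card_image PiE_iff image_subset_iff)
  \<comment> \<open>Two equal rows make the determinant vanish, so the number of sets is irrelevant
    here.\<close>
  next
    case False
    then obtain i j where "i < k" "j < k" "i \<noteq> j" "f i = f j"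
      by (auto simp: inj_on_def)
    then have "det (mat k k (\<lambda>(a, b). B (f a) b)) = 0"
      by (intro det_identical_rows[of _ k i j]) (auto simp: row_def)
    then show ?thesis by simp
  qed
  have "(\<Sum>S\<in>row_sets n s. det (mat k k (\<lambda>(a, b). \<Sum>r\<in>S. A r a * B r b))) =
      (\<Sum>S\<in>row_sets n s. sum ?g (?F S))"
    by (intro sum.cong refl det_sum_outer) (auto simp: row_sets_def intro: finite_subset)
  \<comment> \<open>Functions into \<open>S\<close> become functions into \<open>{0..<n}\<close>
    with a side condition, so that the two sums can be exchanged.\<close>
  also have "\<dots> = (\<Sum>S\<in>row_sets n s. \<Sum>f | f \<in> ?F {0..<n} \<and> f ` {0..<k} \<subseteq> S. ?g f)"
    by (intro sum.cong refl) (auto simp: row_sets_def PiE_iff extensional_def)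
  also have "\<dots> = (\<Sum>f\<in>?F {0..<n}. \<Sum>S | S \<in> row_sets n s \<and> f ` {0..<k} \<subseteq> S. ?g f)"
    by (rule sum.swap_restrict[OF finite_row_sets finF])
  also have "\<dots> = (\<Sum>f\<in>?F {0..<n}. of_nat ((n - k) choose (s - k)) * ?g f)"
    by (intro sum.cong refl) (simp only: sum_constant count)
  also have "\<dots> = of_nat ((n - k) choose (s - k)) * det (mat k k (\<lambda>(a, b). \<Sum>r\<in>{0..<n}. A r a * B r b))"
    by (simp only: det_sum_outer[OF finite_atLeastLessThan] sum_distrib_left)
  finally show ?thesis .
qed

section \<open>Gram matrices of row sets and their adjugates\<close>

text \<open>Rows keep their original indices instead of being renumbered as in a submatrix; as a sum
  of outer products it fits the expansions above.\<close>

definition row_gram :: "real mat \<Rightarrow> nat set \<Rightarrow> real mat" where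
  "row_gram X S = mat (dim_col X) (dim_col X) (\<lambda>(i, j). \<Sum>r\<in>S. X $$ (r, i) * X $$ (r, j))"

lemma gram_row_submatrix:
  assumes "S \<subseteq> {0..<dim_row X}"
  shows "gram (row_submatrix X S) = row_gram X S"
proof -
  have fS: "finite S" using assms finite_subset by blast
  have S: "{i. i < dim_row X \<and> i \<in> S} = S" using assms by auto
  \<comment> \<open>\<open>pick S\<close> lists \<open>S\<close> in increasing order; its inverse
    sends an element to the number of smaller ones.\<close>
  have bij: "bij_betw (pick S) {0..<card S} S"
  proof (rule bij_betw_byWitness[where f' = "\<lambda>i. card {a \<in> S. a < i}"])
    show "(\<lambda>i. card {a \<in> S. a < i}) ` S \<subseteq> {0..<card S}"
      using fS by (auto intro!: psubset_card_mono)
  qed (auto simp: card_pick pick_card_in_set pick_in_set)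
  show ?thesis
    unfolding gram_def row_submatrix_def submatrix_def row_gram_def S
    by (rule eq_matI)
      (auto simp: scalar_prod_def pick_UNIV sum.reindex_bij_betw[OF bij, symmetric])
qed

lemma gram_eq_row_gram: "gram X = row_gram X {0..<dim_row X}"
  unfolding gram_def row_gram_def by (rule eq_matI) (auto simp: scalar_prod_def)

lemma row_gram_carrier: "X \<in> carrier_mat n d \<Longrightarrow> row_gram X S \<in> carrier_mat d d"
  unfolding row_gram_def by auto

text \<open>With \<open>A = B\<close> the symmetric expansion is a sum of squares.\<close>

lemma det_row_gram_nonneg:
  assumes "finite S"
  shows "0 \<le> det (row_gram X S)"
proof -
  have "0 \<le> fact (dim_col X) * det (row_gram X S)"
    unfolding row_gram_def det_sum_outer_symmetric[OF assms]
    by (intro sum_nonneg) simp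
  then show ?thesis by (simp add: zero_le_mult_iff not_le[THEN iffD2, OF fact_gt_zero])
qed

text \<open>Deleting a row and a column of a sum of outer products leaves one of size
  \<open>k\<close>, so the expansions apply to adjugates. The roles of \<open>i\<close> and
  \<open>j\<close> are swapped because the adjugate transposes the cofactors.\<close>

lemma adj_row_gram_index:
  assumes X: "X \<in> carrier_mat n (Suc k)" and ij: "i < Suc k" "j < Suc k"
  shows "adj_mat (row_gram X S) $$ (i, j) = (-1) ^ (i + j) *
    det (mat k k (\<lambda>(a, b). \<Sum>r\<in>S. X $$ (r, insert_index j a) * X $$ (r, insert_index i b)))"
proof -
  have "mat_delete (row_gram X S) j i =
      mat k k (\<lambda>(a, b). \<Sum>r\<in>S. X $$ (r, insert_index j a) * X $$ (r, insert_index i b))"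
    using X ij by (intro eq_matI) (auto simp: mat_delete_def row_gram_def insert_index_def)
  then show ?thesis
    using X ij by (simp add: adj_mat_def cofactor_def row_gram_def add.commute)
qed

lemma sum_row_sets_adj_row_gram:
  assumes X: "X \<in> carrier_mat n d" and "d \<le> s" and ij: "i < d" "j < d"
  shows "(\<Sum>S\<in>row_sets n s. adj_mat (row_gram X S) $$ (i, j)) =
    real ((n - (d - 1)) choose (s - (d - 1))) * adj_mat (row_gram X {0..<n}) $$ (i, j)"
proof -
  obtain k where d: "d = Suc k" using ij by (cases d) auto
  show ?thesis
    using assms(2) ij unfolding d
    by (subst (1 2) adj_row_gram_index[OF X[unfolded d]])
      (simp_all add: sum_distrib_left[symmetric] sum_row_sets_det_sum_outer)
qed

lemma adj_row_gram_commute: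
  assumes X: "X \<in> carrier_mat n d" and ij: "i < d" "j < d"
  shows "adj_mat (row_gram X S) $$ (i, j) = adj_mat (row_gram X S) $$ (j, i)"
proof -
  obtain k where d: "d = Suc k" using ij by (cases d) auto
  let ?M = "\<lambda>i j. mat k k (\<lambda>(a, b). \<Sum>r\<in>S. X $$ (r, insert_index j a) * X $$ (r, insert_index i b))"
  have "det (?M i j) = det (transpose_mat (?M i j))"
    by (rule det_transpose[symmetric]) auto
  also have "transpose_mat (?M i j) = ?M j i"
    by (rule eq_matI) (auto simp: mult.commute)
  finally show ?thesis
    using ij unfolding d by (simp add: adj_row_gram_index[OF X[unfolded d]] add.commute)
qed

text \<open>Up to the factor \<open>fact k\<close>, the adjugate is a sum of rank-one matrices with
  entries \<open>m f i * m f j\<close>, so its quadratic form is a sum of squares.\<close>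

lemma adj_row_gram_quadratic_form_nonneg:
  assumes X: "X \<in> carrier_mat n d" and S: "finite S"
  shows "0 \<le> (\<Sum>i<d. \<Sum>j<d. v i * v j * adj_mat (row_gram X S) $$ (i, j))"
proof (cases d)
  case 0
  then show ?thesis by simp
next
  case (Suc k)
  let ?F = "{0..<k} \<rightarrow>\<^sub>E S"
  \<comment> \<open>The signed minor of the rows chosen by \<open>f\<close> with column
    \<open>i\<close> left out; the sign of the cofactor splits as
    \<open>(-1) ^ i * (-1) ^ j\<close>.\<close>
  define m where "m f i = (-1) ^ i * det (mat k k (\<lambda>(a, b). X $$ (f a, insert_index i b)))"
    for f :: "nat \<Rightarrow> nat" and i
  have adj: "fact k * adj_mat (row_gram X S) $$ (i, j) = (\<Sum>f\<in>?F. m f i * m f j)"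
    if "i < d" "j < d" for i j
  proof -
    have "fact k * adj_mat (row_gram X S) $$ (i, j) = (-1) ^ (i + j) * (fact k *
        det (mat k k (\<lambda>(a, b). \<Sum>r\<in>S. X $$ (r, insert_index j a) * X $$ (r, insert_index i b))))"
      using that unfolding Suc by (simp add: adj_row_gram_index[OF X[unfolded Suc]])
    also have "\<dots> = (\<Sum>f\<in>?F. m f i * m f j)"
      unfolding det_sum_outer_symmetric[OF S] by (simp add: sum_distrib_left m_def power_add mult_ac)
    finally show ?thesis .
  qed
  have "fact k * (\<Sum>i<d. \<Sum>j<d. v i * v j * adj_mat (row_gram X S) $$ (i, j)) =
      (\<Sum>i<d. \<Sum>j<d. v i * v j * (fact k * adj_mat (row_gram X S) $$ (i, j)))"
    by (simp add: sum_distrib_left mult_ac)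
  also have "\<dots> = (\<Sum>i<d. \<Sum>j<d. \<Sum>f\<in>?F. (v i * m f i) * (v j * m f j))"
    by (simp add: adj sum_distrib_left mult_ac)
  also have "\<dots> = (\<Sum>i<d. \<Sum>f\<in>?F. \<Sum>j<d. (v i * m f i) * (v j * m f j))"
    by (rule sum.cong[OF refl], rule sum.swap)
  also have "\<dots> = (\<Sum>f\<in>?F. \<Sum>i<d. \<Sum>j<d. (v i * m f i) * (v j * m f j))"
    by (rule sum.swap)
  also have "\<dots> = (\<Sum>f\<in>?F. (\<Sum>i<d. v i * m f i)\<^sup>2)"
    by (simp add: power2_eq_square sum_product)
  also have "\<dots> \<ge> 0" by (intro sum_nonneg) simp
  finally show ?thesis by (simp add: zero_le_mult_iff not_le[THEN iffD2, OF fact_gt_zero])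
qed

section \<open>Quadratic forms, Cramer's rule and full column rank\<close>

lemma quadratic_form_eq_sum:
  fixes A :: "'a :: comm_semiring_0 mat"
  assumes "A \<in> carrier_mat d d" "v \<in> carrier_vec d"
  shows "v \<bullet> (A *\<^sub>v v) = (\<Sum>i<d. \<Sum>j<d. v $ i * v $ j * A $$ (i, j))"
  using assms by (auto simp: scalar_prod_def sum_distrib_left atLeast0LessThan mult_ac intro!: sum.cong)

lemma mat_inv_eq_adj:
  assumes A: "A \<in> carrier_mat d d" and "det A \<noteq> 0"
  shows "mat_inv A = (1 / det A) \<cdot>\<^sub>m adj_mat A"
proof -
  note adj = adj_mat[OF A]
  \<comment> \<open>A nonzero determinant excludes \<open>None\<close>, so \<open>the\<close> in
    \<open>mat_inv\<close> yields a genuine inverse.\<close>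
  obtain B where B: "mat_inverse A = Some B"
    using mat_inverse(1)[OF A, of "()"] det_non_zero_imp_unit[OF A assms(2), of "()"] by fastforce
  have inv: "A * B = 1\<^sub>m d" "B * A = 1\<^sub>m d" "B \<in> carrier_mat d d"
    using mat_inverse(2)[OF A B] by auto
  have "adj_mat A = adj_mat A * (A * B)" using inv adj by simp
  also have "\<dots> = adj_mat A * A * B" using inv adj A by (metis assoc_mult_mat)
  also have "\<dots> = det A \<cdot>\<^sub>m B"
    using inv adj by (simp add: mult_smult_assoc_mat[of _ d d _ d])
  finally show ?thesis
    using B inv assms(2) by (auto simp: mat_inv_def intro!: eq_matI)
qed

text \<open>The rank is the size of a maximal independent subset of the set of columns, which has
  fewer than \<open>nc\<close> elements if a column repeats. Distinctness lets independence of that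
  set speak about the kernel of \<open>A\<close>.\<close>

lemma (in vec_space) full_rank_distinct_cols:
  assumes "A \<in> carrier_mat n nc" "rank A = nc"
  shows "distinct (cols A)"
proof -
  obtain S where S: "maximal S (\<lambda>T. T \<subseteq> set (cols A) \<and> lin_indpt T)"
    using maximal_exists[of "(\<lambda>T. T \<subseteq> set (cols A) \<and> lin_indpt T)" "card (set (cols A))" "{}"]
    by (meson List.finite_set card_mono empty_iff empty_subsetI finite_lin_indpt2 rev_finite_subset)
  then have "card S \<le> card (set (cols A))" by (simp add: card_mono maximal_def)
  moreover have "card S = length (cols A)"
    using rank_card_indpt[OF assms(1) S] assms by simp
  ultimately show ?thesis
    by (metis card_distinct card_length le_antisym)
qed

text \<open>A kernel vector \<open>v\<close> of the Gram matrix makes the squared norm of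
  \<open>X *\<^sub>v v\<close> zero, so the columns of \<open>X\<close> would be dependent.\<close>

lemma det_gram_nonzero:
  assumes X: "X \<in> carrier_mat n d" and rank: "vec_space.rank n X = d"
  shows "det (gram X) \<noteq> 0"
proof
  interpret vec_space "TYPE(real)" n .
  assume "det (gram X) = 0"
  moreover have G: "gram X \<in> carrier_mat d d" using X by (simp add: gram_def)
  ultimately obtain v where v: "v \<in> carrier_vec d" "v \<noteq> 0\<^sub>v d" "gram X *\<^sub>v v = 0\<^sub>v d"
    using det_0_iff_vec_prod_zero_field[OF G] by blast
  have Xv: "X *\<^sub>v v \<in> carrier_vec n" using X v by simp
  have "transpose_mat X *\<^sub>v (X *\<^sub>v v) = 0\<^sub>v d"
    using X v by (simp add: gram_def assoc_mult_mat_vec[of _ d n _ d])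
  then have "(X *\<^sub>v v) \<bullet> (X *\<^sub>v v) = 0"
    using transpose_vec_mult_scalar[OF X v(1) Xv] v by simp
  then have "X *\<^sub>v v = 0\<^sub>v n"
    using Xv by (simp add: conjugate_square_eq_0_vec[OF Xv, symmetric] conjugate_vec_def)
  then show False
    using lin_depI[OF X v(1,2)] full_rank_lin_indpt[OF X rank] full_rank_distinct_cols[OF X rank]
    by blast
qed

lemma det_row_gram_pos:
  assumes X: "X \<in> carrier_mat n d" and rank: "vec_space.rank n X = d"
  shows "det (row_gram X {0..<n}) > 0"
  using det_gram_nonzero[OF assms] det_row_gram_nonneg[of "{0..<n}" X] X
  by (simp add: gram_eq_row_gram)

section \<open>The expected inverse under volume sampling\<close>

theorem theorem2p6:
  fixes X :: "real mat" and n d s :: nat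
  assumes "X \<in> carrier_mat n d"
    and "d \<le> n"
    and "vec_space.rank n X = d"
    and "s \<in> {d..n}"
  shows "(vol_full_support X s \<longrightarrow>
           vol_expectation X s (\<lambda>S. mat_inv (gram (row_submatrix X S))) =
             ((real n - real d + 1) / (real s - real d + 1)) \<cdot>\<^sub>m mat_inv (gram X)) \<and>
         (\<not> vol_full_support X s \<longrightarrow>
           vol_expectation X s (\<lambda>S. mat_inv (gram (row_submatrix X S))) \<preceq>\<^sub>L
             ((real n - real d + 1) / (real s - real d + 1)) \<cdot>\<^sub>m mat_inv (gram X))"
proof -
  note X = assms(1)
  have s: "d \<le> s" "s \<le> n" using assms(4) by auto
  \<comment> \<open>The normalising constant of \<open>vol_prob\<close>.\<close>
  define C where "C = real ((n - d) choose (s - d)) * det (row_gram X {0..<n})"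
  define adj where "adj S i j = adj_mat (row_gram X S) $$ (i, j)" for S i j
  let ?E = "vol_expectation X s (\<lambda>S. mat_inv (gram (row_submatrix X S)))"
  let ?R = "((real n - real d + 1) / (real s - real d + 1)) \<cdot>\<^sub>m mat_inv (gram X)"
  let ?pos = "{S \<in> row_sets n s. det (row_gram X S) > 0}"
  let ?sing = "{S \<in> row_sets n s. \<not> det (row_gram X S) > 0}"
  have detG: "det (row_gram X {0..<n}) > 0" by (rule det_row_gram_pos[OF X assms(3)])
  then have C: "C > 0" using s by (simp add: C_def)
  have gramX: "gram X = row_gram X {0..<n}" using X by (simp add: gram_eq_row_gram)
  have sub: "gram (row_submatrix X S) = row_gram X S" if "S \<in> row_sets n s" for S
    using that X by (intro gram_row_submatrix) (auto simp: row_sets_def)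
  have prob: "vol_prob X s S = det (row_gram X S) / C" if "S \<in> row_sets n s" for S
    using X by (simp add: vol_prob_def sub[OF that] gramX C_def)
  have supp: "{S \<in> row_sets n s. vol_prob X s S > 0} = ?pos"
    using C by (auto simp: prob zero_less_divide_iff)
  have mat_inv_index: "mat_inv (row_gram X S) $$ (i, j) = adj S i j / det (row_gram X S)"
    if "det (row_gram X S) \<noteq> 0" "i < d" "j < d" for S i j
    using that X adj_mat(1)[OF row_gram_carrier[OF X, of S]]
    by (simp add: mat_inv_eq_adj[OF row_gram_carrier[OF X]] adj_def)
  have E: "?E $$ (i, j) = (\<Sum>S\<in>?pos. adj S i j) / C" if "i < d" "j < d" for i j
    using X that
    by (auto simp: vol_expectation_def supp prob sub mat_inv_index sum_divide_distrib intro!: sum.cong)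
  have R: "?R $$ (i, j) = (\<Sum>S\<in>row_sets n s. adj S i j) / C" if ij: "i < d" "j < d" for i j
  proof -
    \<comment> \<open>The index \<open>i < d\<close> gives \<open>d > 0\<close>, so
      \<open>d - 1\<close> is not truncated.\<close>
    have "n - (d - 1) = Suc (n - d)" "s - (d - 1) = Suc (s - d)" using s ij by auto
    then have "(\<Sum>S\<in>row_sets n s. adj S i j) = real (Suc (n - d) choose Suc (s - d)) * adj {0..<n} i j"
      using sum_row_sets_adj_row_gram[OF X s(1) ij] by (simp add: adj_def)
    \<comment> \<open>Absorption identity: the count of supersets divided by the binomial in
      \<open>C\<close> is exactly the factor in \<open>?R\<close>.\<close>
    moreover have "real (Suc (s - d)) * real (Suc (n - d) choose Suc (s - d)) =
        real (Suc (n - d)) * real ((n - d) choose (s - d))"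
      using Suc_times_binomial_eq[of "n - d" "s - d"] by (simp only: of_nat_mult[symmetric] mult.commute)
    then have "real (Suc (n - d) choose Suc (s - d)) =
        (real n - real d + 1) / (real s - real d + 1) * real ((n - d) choose (s - d))"
      using s by (simp add: of_nat_diff field_simps)
    moreover have "?R $$ (i, j) = (real n - real d + 1) / (real s - real d + 1) * (mat_inv (gram X) $$ (i, j))"
      using ij X adj_mat(1)[OF row_gram_carrier[OF X, of "{0..<n}"]] detG
      by (simp add: gramX mat_inv_eq_adj[OF row_gram_carrier[OF X]])
    ultimately show ?thesis
      using ij detG s diff_le_mono[of s n d] by (simp add: gramX mat_inv_index C_def)
  qed
  have dims: "?E \<in> carrier_mat d d" "?R \<in> carrier_mat d d"
    using X adj_mat(1)[OF row_gram_carrier[OF X, of "{0..<n}"]] detG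
    by (auto simp: vol_expectation_def gramX mat_inv_eq_adj[OF row_gram_carrier[OF X]])
  have diff: "(?R - ?E) $$ (i, j) = (\<Sum>S\<in>?sing. adj S i j) / C" if ij: "i < d" "j < d" for i j
  proof -
    have "(\<Sum>S\<in>row_sets n s. adj S i j) = (\<Sum>S\<in>?pos \<union> ?sing. adj S i j)"
      by (rule arg_cong2[of _ _ _ _ sum]) auto
    also have "\<dots> = (\<Sum>S\<in>?pos. adj S i j) + (\<Sum>S\<in>?sing. adj S i j)"
      by (rule sum.union_disjoint) (auto simp: finite_row_sets)
    finally have "(\<Sum>S\<in>row_sets n s. adj S i j) - (\<Sum>S\<in>?pos. adj S i j) = (\<Sum>S\<in>?sing. adj S i j)"
      by simp
    moreover have "(?R - ?E) $$ (i, j) = ?R $$ (i, j) - ?E $$ (i, j)"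
      using dims ij by (intro index_minus_mat) auto
    ultimately show ?thesis
      by (simp only: E[OF ij] R[OF ij] diff_divide_distrib[symmetric])
  qed
  have "?E = ?R" if "vol_full_support X s"
  proof (rule eq_matI)
    \<comment> \<open>Under full support the sums in \<open>E\<close> and \<open>R\<close> range
      over the same sets.\<close>
    have "?pos = row_sets n s"
      using that X by (auto simp: vol_full_support_def sub)
    moreover have "i < d" "j < d" if "i < dim_row ?R" "j < dim_col ?R" for i j
      using that dims by auto
    ultimately show "?E $$ (i, j) = ?R $$ (i, j)" if "i < dim_row ?R" "j < dim_col ?R" for i j
      using that by (simp only: E R)
  qed (use dims in auto)
  moreover have "?E \<preceq>\<^sub>L ?R"
  proof -
    have "0 \<le> v \<bullet> ((?R - ?E) *\<^sub>v v)" if v: "v \<in> carrier_vec d" for v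
    proof -
      have "v \<bullet> ((?R - ?E) *\<^sub>v v) = (\<Sum>i<d. \<Sum>j<d. v $ i * v $ j * (?R - ?E) $$ (i, j))"
        using v dims by (intro quadratic_form_eq_sum) auto
      \<comment> \<open>The sum over sets is moved outermost, so that each set in
        \<open>?sing\<close> contributes one nonnegative quadratic form divided by
        \<open>C > 0\<close>. \<open>index_minus_mat\<close> is removed because it would split the
        entry before \<open>diff\<close> applies.\<close>
      also have "\<dots> = (\<Sum>i<d. \<Sum>j<d. \<Sum>S\<in>?sing. v $ i * v $ j * adj S i j / C)"
        by (simp add: diff sum_distrib_left sum_divide_distrib del: index_minus_mat)
      also have "\<dots> = (\<Sum>i<d. \<Sum>S\<in>?sing. \<Sum>j<d. v $ i * v $ j * adj S i j / C)"
        by (rule sum.cong[OF refl], rule sum.swap)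
      also have "\<dots> = (\<Sum>S\<in>?sing. \<Sum>i<d. \<Sum>j<d. v $ i * v $ j * adj S i j / C)"
        by (rule sum.swap)
      also have "\<dots> = (\<Sum>S\<in>?sing. (\<Sum>i<d. \<Sum>j<d. v $ i * v $ j * adj S i j) / C)"
        by (simp add: sum_divide_distrib)
      also have "\<dots> \<ge> 0"
        using C unfolding adj_def
        by (intro sum_nonneg divide_nonneg_pos adj_row_gram_quadratic_form_nonneg[OF X])
          (auto simp: row_sets_def intro: finite_subset)
      finally show ?thesis .
    qed
    \<comment> \<open>\<open>psd_mat\<close> also demands symmetry, which is inherited from the
      adjugates.\<close>
    moreover have "transpose_mat (?R - ?E) = ?R - ?E"
    proof (rule eq_matI)
      fix i j assume "i < dim_row (?R - ?E)" "j < dim_col (?R - ?E)"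
      then have ij: "i < d" "j < d" using dims by auto
      then have "transpose_mat (?R - ?E) $$ (i, j) = (?R - ?E) $$ (j, i)" using dims by simp
      then show "transpose_mat (?R - ?E) $$ (i, j) = (?R - ?E) $$ (i, j)"
        by (simp add: diff ij adj_def adj_row_gram_commute[OF X ij] del: index_minus_mat)
    qed (use dims in auto)
    ultimately show ?thesis
      using carrier_matD[OF dims(1)] carrier_matD[OF dims(2)] by (simp add: loewner_le_def psd_mat_def)
  qed
  ultimately show ?thesis by blast
qed

end
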